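(* Let $G$ be a mixed identity-free (MIF) countable discrete group and let $G \curvearrowright (X,\mu)$ be an action of one of the following two types: (a) a faithful ergodic generalized Bernoulli action, i.e. $(X,\mu)=(X_0,\mu_0)^I$ for a non-trivial standard probability space $(X_0,\mu_0)$ and a countably infinite set $I$ on which $G$ acts, with $G$ acting on $X_0^I$ by $(g\cdot x)_i = x_{g^{-1}i}$; or (b) a faithful affine action on a compact abelian group with its normalized Haar measure, i.e. $X=K$ is a compact abelian group, $\mu$ is its normalized Haar measure, and every $g\in G$ acts by a map of the form $k\mapsto b_g\,\alpha_g(k)$ with $b_g\in K$ and $\alpha_g$ a continuous group automorphism of $K$. Then $G \curvearrowright (X,\mu)$ is essentially free, i.e. $\mu(\{x\in X \mid gx=x\})=0$ for every $g\in G\setminus\{e\}$.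
   Context: Let $F_n=\langle x_1,\dots,x_n\rangle$ be the free group on $n$ generators. For $w\in G*F_n$ and $g_1,\dots,g_n\in G$, $w(g_1,\dots,g_n)\in G$ denotes the image of $w$ under the homomorphism $G*F_n\to G$ that is the identity on $G$ and sends $x_i$ to $g_i$. A countable discrete group $G$ satisfies a mixed identity if there are $n\ge 1$ and a nontrivial element $w\in G*F_n$ with $w(g_1,\dots,g_n)=e$ for all $g_1,\dots,g_n\in G$. The group $G$ is mixed identity-free (MIF) if it satisfies no mixed identity. A probability space $(X_0,\mu_0)$ is non-trivial if $\mu_0$ is not concentrated on a single point. An action preserving a probability measure $\mu$ is faithful if for every $g\ne e$ the set $\{x \mid gx = x\}$ does not have full measure (i.e. no nontrivial element acts as the identity almost everywhere); it is ergodic if every $G$-invariant measurable set has measure $0$ or $1$. Compact groups are assumed Hausdorff. *)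

theory Defs
  imports "HOL-Probability.Probability" "HOL-Algebra.Group_Action"
begin

section \<open>Mixed identities\<close>

text \<open>
  The free product \<open>G * F\<^sub>n\<close> is the set of words in the elements of \<open>G\<close> and the letters
  \<open>x\<^sub>i\<close>, \<open>x\<^sub>i\<inverse>\<close> with \<open>i < n\<close>, modulo the congruence generated by the multiplication of
  \<open>G\<close> and by the free cancellations. The generators are numbered from 0;
  \<open>Gen i True\<close> stands for \<open>x\<^sub>i\<close> and \<open>Gen i False\<close> for its inverse.
\<close>

datatype 'g letter = Const 'g | Gen nat bool

definition mixed_words :: "('g, 'r) monoid_scheme \<Rightarrow> nat \<Rightarrow> 'g letter list set" where
  "mixed_words G n = lists (Const ` carrier G \<union> {Gen i b | i b. i < n})"

inductive mixed_eq ::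
    "('g, 'r) monoid_scheme \<Rightarrow> nat \<Rightarrow> 'g letter list \<Rightarrow> 'g letter list \<Rightarrow> bool"
  for G (structure) and n :: nat where
  refl: "u \<in> mixed_words G n \<Longrightarrow> mixed_eq G n u u"
| sym: "mixed_eq G n u v \<Longrightarrow> mixed_eq G n v u"
| trans: "mixed_eq G n u v \<Longrightarrow> mixed_eq G n v w \<Longrightarrow> mixed_eq G n u w"
| mult: "\<lbrakk>u \<in> mixed_words G n; v \<in> mixed_words G n; a \<in> carrier G; b \<in> carrier G\<rbrakk>
    \<Longrightarrow> mixed_eq G n (u @ [Const a, Const b] @ v) (u @ [Const (a \<otimes> b)] @ v)"
| unit: "\<lbrakk>u \<in> mixed_words G n; v \<in> mixed_words G n\<rbrakk>
    \<Longrightarrow> mixed_eq G n (u @ [Const \<one>] @ v) (u @ v)"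
| cancel: "\<lbrakk>u \<in> mixed_words G n; v \<in> mixed_words G n; i < n\<rbrakk>
    \<Longrightarrow> mixed_eq G n (u @ [Gen i b, Gen i (\<not> b)] @ v) (u @ v)"

definition mixed_rel ::
    "('g, 'r) monoid_scheme \<Rightarrow> nat \<Rightarrow> ('g letter list \<times> 'g letter list) set" where
  "mixed_rel G n = {(u, v). mixed_eq G n u v}"

definition free_prod_free :: "('g, 'r) monoid_scheme \<Rightarrow> nat \<Rightarrow> 'g letter list set monoid" where
  "free_prod_free G n =
    \<lparr>carrier = mixed_words G n // mixed_rel G n,
     mult = (\<lambda>A B. \<Union>u\<in>A. \<Union>v\<in>B. mixed_rel G n `` {u @ v}),
     one = mixed_rel G n `` {[]}\<rparr>"

fun eval_letter :: "('g, 'r) monoid_scheme \<Rightarrow> (nat \<Rightarrow> 'g) \<Rightarrow> 'g letter \<Rightarrow> 'g" where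
  "eval_letter G g (Const a) = a"
| "eval_letter G g (Gen i b) = (if b then g i else inv\<^bsub>G\<^esub> g i)"

definition eval_word :: "('g, 'r) monoid_scheme \<Rightarrow> (nat \<Rightarrow> 'g) \<Rightarrow> 'g letter list \<Rightarrow> 'g" where
  "eval_word G g u = foldr (\<lambda>l a. eval_letter G g l \<otimes>\<^bsub>G\<^esub> a) u \<one>\<^bsub>G\<^esub>"

text \<open>
  \<open>eval_mixed G g w\<close> is \<open>w(g\<^sub>0, \<dots>, g\<^sub>n\<^sub>-\<^sub>1)\<close>. All representatives of the class \<open>w\<close> have the same
  value, see \<open>eval_mixed_class\<close>; the lemmas after it show that this is the homomorphism
  that is the identity on \<open>G\<close> and sends \<open>x\<^sub>i\<close> to \<open>g\<^sub>i\<close>.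
\<close>

definition eval_mixed :: "('g, 'r) monoid_scheme \<Rightarrow> (nat \<Rightarrow> 'g) \<Rightarrow> 'g letter list set \<Rightarrow> 'g" where
  "eval_mixed G g w = the_elem (eval_word G g ` w)"

definition satisfies_mixed_identity :: "('g, 'r) monoid_scheme \<Rightarrow> bool" where
  "satisfies_mixed_identity G \<longleftrightarrow>
    (\<exists>n\<ge>1. \<exists>w\<in>carrier (free_prod_free G n). w \<noteq> \<one>\<^bsub>free_prod_free G n\<^esub> \<and>
      (\<forall>g \<in> {..<n} \<rightarrow> carrier G. eval_mixed G g w = \<one>\<^bsub>G\<^esub>))"

definition MIF :: "('g, 'r) monoid_scheme \<Rightarrow> bool" where
  "MIF G \<longleftrightarrow> \<not> satisfies_mixed_identity G"

lemma append_mixed_words [simp]: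
  "u @ v \<in> mixed_words G n \<longleftrightarrow> u \<in> mixed_words G n \<and> v \<in> mixed_words G n"
  by (simp add: mixed_words_def)

lemma Nil_mixed_words [simp]: "[] \<in> mixed_words G n"
  by (simp add: mixed_words_def)

lemma Cons_mixed_words [simp]:
  "Const a # u \<in> mixed_words G n \<longleftrightarrow> a \<in> carrier G \<and> u \<in> mixed_words G n"
  "Gen i b # u \<in> mixed_words G n \<longleftrightarrow> i < n \<and> u \<in> mixed_words G n"
  by (auto simp: mixed_words_def)

lemma (in group) mixed_eq_words:
  "mixed_eq G n u v \<Longrightarrow> u \<in> mixed_words G n \<and> v \<in> mixed_words G n"
  by (induction rule: mixed_eq.induct) auto

lemma (in group) equiv_mixed_rel: "equiv (mixed_words G n) (mixed_rel G n)"
  unfolding equiv_def refl_on_def sym_def trans_def mixed_rel_def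
  using mixed_eq_words by (auto intro: mixed_eq.intros)

lemma (in group) mixed_eq_context:
  assumes "mixed_eq G n u v" "p \<in> mixed_words G n" "q \<in> mixed_words G n"
  shows "mixed_eq G n (p @ u @ q) (p @ v @ q)"
  using assms
proof (induction rule: mixed_eq.induct)
  case (mult u v a b)
  then show ?case using mixed_eq.mult[of "p @ u" G n "v @ q" a b] by simp
next
  case (unit u v)
  then show ?case using mixed_eq.unit[of "p @ u" G n "v @ q"] by simp
next
  case (cancel u v i b)
  then show ?case using mixed_eq.cancel[of "p @ u" G n "v @ q" i b] by simp
qed (auto intro: mixed_eq.intros)

lemma (in group) mixed_eq_append:
  assumes "mixed_eq G n u u'" "mixed_eq G n v v'"
  shows "mixed_eq G n (u @ v) (u' @ v')"
proof -
  have "mixed_eq G n (u @ v) (u' @ v)"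
    using mixed_eq_context[OF assms(1), of "[]" v] mixed_eq_words[OF assms(2)] by simp
  moreover have "mixed_eq G n (u' @ v) (u' @ v')"
    using mixed_eq_context[OF assms(2), of u' "[]"] mixed_eq_words[OF assms(1)] by simp
  ultimately show ?thesis by (rule mixed_eq.trans)
qed

lemma (in group) mult_free_prod_free:
  assumes "u \<in> mixed_words G n" "v \<in> mixed_words G n"
  shows "(mixed_rel G n `` {u}) \<otimes>\<^bsub>free_prod_free G n\<^esub> (mixed_rel G n `` {v})
    = mixed_rel G n `` {u @ v}"
proof -
  have "mixed_rel G n `` {u' @ v'} = mixed_rel G n `` {u @ v}"
    if "u' \<in> mixed_rel G n `` {u}" "v' \<in> mixed_rel G n `` {v}" for u' v'
  proof -
    have "mixed_eq G n (u @ v) (u' @ v')"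
      using that by (intro mixed_eq_append) (simp_all add: mixed_rel_def)
    then show ?thesis
      using equiv_class_eq[OF equiv_mixed_rel, of "u @ v" "u' @ v'" n]
      by (simp add: mixed_rel_def)
  qed
  then have "(\<Union>u'\<in>mixed_rel G n `` {u}. \<Union>v'\<in>mixed_rel G n `` {v}. mixed_rel G n `` {u' @ v'})
      = (\<Union>u'\<in>mixed_rel G n `` {u}. \<Union>v'\<in>mixed_rel G n `` {v}. mixed_rel G n `` {u @ v})"
    by (auto intro!: SUP_cong simp del: Image_singleton_iff)
  moreover have "u \<in> mixed_rel G n `` {u}" "v \<in> mixed_rel G n `` {v}"
    using assms by (simp_all add: mixed_rel_def mixed_eq.refl)
  ultimately show ?thesis
    unfolding free_prod_free_def by (simp only: monoid.simps UN_constant) force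
qed

lemma (in group) carrier_free_prod_free:
  "w \<in> carrier (free_prod_free G n) \<longleftrightarrow>
    (\<exists>u \<in> mixed_words G n. w = mixed_rel G n `` {u})"
  by (auto simp: free_prod_free_def quotient_def)

lemma (in group) mixed_left_inverse:
  assumes "u \<in> mixed_words G n"
  shows "\<exists>v \<in> mixed_words G n. mixed_eq G n (v @ u) []"
  using assms
proof (induction u)
  case Nil
  then show ?case by (auto intro!: bexI[of _ "[]"] mixed_eq.refl)
next
  case (Cons l u)
  then have u: "u \<in> mixed_words G n" and l: "[l] \<in> mixed_words G n"
    using append_mixed_words[of "[l]" u G n] by auto
  obtain v where v: "v \<in> mixed_words G n" "mixed_eq G n (v @ u) []" using Cons.IH u by blast
  have "\<exists>k. [k] \<in> mixed_words G n \<and> mixed_eq G n [k, l] []"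
  proof (cases l)
    case (Const a)
    then have a: "a \<in> carrier G" using l by simp
    have "mixed_eq G n [Const (inv a), Const a] [Const \<one>]"
      using mixed_eq.mult[of "[]" G n "[]" "inv a" a] a by simp
    moreover have "mixed_eq G n [Const \<one>] []"
      using mixed_eq.unit[of "[]" G n "[]"] by simp
    ultimately show ?thesis using Const a
      by (intro exI[of _ "Const (inv a)"]) (auto intro: mixed_eq.trans)
  next
    case (Gen i b)
    then show ?thesis using mixed_eq.cancel[of "[]" G n "[]" i "\<not> b"] l
      by (intro exI[of _ "Gen i (\<not> b)"]) auto
  qed
  then obtain k where k: "[k] \<in> mixed_words G n" "mixed_eq G n [k, l] []" by blast
  have "mixed_eq G n (v @ [k, l] @ u) (v @ [] @ u)"
    by (rule mixed_eq_context[OF k(2) v(1) u])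
  then have "mixed_eq G n ((v @ [k]) @ l # u) []" using v(2)
    by (auto intro: mixed_eq.trans)
  then show ?case using v(1) k(1) by (intro bexI[of _ "v @ [k]"]) simp_all
qed

lemma (in group) group_free_prod_free: "group (free_prod_free G n)"
proof (rule groupI)
  let ?P = "free_prod_free G n"
  have one: "\<one>\<^bsub>?P\<^esub> = mixed_rel G n `` {[]}" by (simp add: free_prod_free_def)
  show "\<one>\<^bsub>?P\<^esub> \<in> carrier ?P" unfolding carrier_free_prod_free one by force
  fix x assume "x \<in> carrier ?P"
  then obtain u where u: "u \<in> mixed_words G n" "x = mixed_rel G n `` {u}"
    unfolding carrier_free_prod_free by blast
  show "\<one>\<^bsub>?P\<^esub> \<otimes>\<^bsub>?P\<^esub> x = x" using u by (simp add: one mult_free_prod_free)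
  obtain v where v: "v \<in> mixed_words G n" "mixed_eq G n (v @ u) []"
    using mixed_left_inverse u by blast
  have "mixed_rel G n `` {v @ u} = mixed_rel G n `` {[]}"
    using v equiv_class_eq[OF equiv_mixed_rel] by (simp add: mixed_rel_def)
  then show "\<exists>y\<in>carrier ?P. y \<otimes>\<^bsub>?P\<^esub> x = \<one>\<^bsub>?P\<^esub>"
    using v u by (intro bexI[of _ "mixed_rel G n `` {v}"])
      (auto simp: one mult_free_prod_free carrier_free_prod_free)
  fix y assume "y \<in> carrier ?P"
  then obtain u' where u': "u' \<in> mixed_words G n" "y = mixed_rel G n `` {u'}"
    unfolding carrier_free_prod_free by blast
  show "x \<otimes>\<^bsub>?P\<^esub> y \<in> carrier ?P" using u u'
    by (auto simp: mult_free_prod_free carrier_free_prod_free intro!: bexI[of _ "u @ u'"])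
  fix z assume "z \<in> carrier ?P"
  then obtain u'' where u'': "u'' \<in> mixed_words G n" "z = mixed_rel G n `` {u''}"
    unfolding carrier_free_prod_free by blast
  show "x \<otimes>\<^bsub>?P\<^esub> y \<otimes>\<^bsub>?P\<^esub> z = x \<otimes>\<^bsub>?P\<^esub> (y \<otimes>\<^bsub>?P\<^esub> z)"
    using u u' u'' by (simp add: mult_free_prod_free)
qed

context group
begin

lemma eval_letter_closed:
  assumes "[l] \<in> mixed_words G n" "g \<in> {..<n} \<rightarrow> carrier G"
  shows "eval_letter G g l \<in> carrier G"
  using assms by (cases l) (auto simp: Pi_iff)

lemma eval_word_closed:
  assumes "u \<in> mixed_words G n" "g \<in> {..<n} \<rightarrow> carrier G"
  shows "eval_word G g u \<in> carrier G"
  using assms(1)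
proof (induction u)
  case (Cons l u)
  then show ?case
    using append_mixed_words[of "[l]" u G n] eval_letter_closed[OF _ assms(2), of l]
    by (simp add: eval_word_def)
qed (simp add: eval_word_def)

lemma eval_word_append:
  assumes "u \<in> mixed_words G n" "v \<in> mixed_words G n" "g \<in> {..<n} \<rightarrow> carrier G"
  shows "eval_word G g (u @ v) = eval_word G g u \<otimes> eval_word G g v"
  using assms(1)
proof (induction u)
  case Nil
  then show ?case using eval_word_closed[OF assms(2,3)] by (simp add: eval_word_def)
next
  case (Cons l u)
  then have l: "[l] \<in> mixed_words G n" "u \<in> mixed_words G n"
    using append_mixed_words[of "[l]" u G n] by auto
  show ?case
    using Cons.IH[OF l(2)] eval_letter_closed[OF l(1) assms(3)]
      eval_word_closed[OF l(2) assms(3)] eval_word_closed[OF assms(2,3)]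
    by (simp add: eval_word_def m_assoc)
qed

lemma eval_word_mixed_eq:
  assumes "mixed_eq G n u v" "g \<in> {..<n} \<rightarrow> carrier G"
  shows "eval_word G g u = eval_word G g v"
  using assms
proof (induction rule: mixed_eq.induct)
  case (mult u v a b)
  have "eval_word G g [Const a, Const b] = eval_word G g [Const (a \<otimes> b)]"
    using mult by (simp add: eval_word_def)
  then show ?case using mult
    by (simp only: eval_word_append append_mixed_words Cons_mixed_words Nil_mixed_words m_closed)
next
  case (unit u v)
  have "eval_word G g [Const \<one>] = \<one>" by (simp add: eval_word_def)
  then show ?case using unit eval_word_closed[of u n g] eval_word_closed[of v n g]
    by (simp add: eval_word_append del: append_Cons)
next
  case (cancel u v i b)
  then have "g i \<in> carrier G" by auto
  then have "eval_word G g [Gen i b, Gen i (\<not> b)] = \<one>" by (simp add: eval_word_def)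
  then show ?case using cancel eval_word_closed[of u n g] eval_word_closed[of v n g]
    by (simp add: eval_word_append del: append_Cons)
qed auto

lemma eval_mixed_class:
  assumes "u \<in> mixed_words G n" "g \<in> {..<n} \<rightarrow> carrier G"
  shows "eval_mixed G g (mixed_rel G n `` {u}) = eval_word G g u"
proof -
  have "eval_word G g ` (mixed_rel G n `` {u}) = {eval_word G g u}"
  proof (rule Set.set_eqI, rule iffI)
    fix a assume "a \<in> eval_word G g ` (mixed_rel G n `` {u})"
    then obtain v where v: "mixed_eq G n u v" "a = eval_word G g v"
      by (auto simp: mixed_rel_def)
    show "a \<in> {eval_word G g u}"
      using eval_word_mixed_eq[OF v(1) assms(2)] v(2) by simp
  next
    fix a assume "a \<in> {eval_word G g u}"
    moreover have "u \<in> mixed_rel G n `` {u}"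
      using mixed_eq.refl[OF assms(1)] by (simp add: mixed_rel_def)
    ultimately show "a \<in> eval_word G g ` (mixed_rel G n `` {u})" by blast
  qed
  then show ?thesis by (simp add: eval_mixed_def)
qed

lemma eval_mixed_hom:
  assumes "g \<in> {..<n} \<rightarrow> carrier G"
  shows "eval_mixed G g \<in> hom (free_prod_free G n) G"
proof (rule homI)
  fix x assume "x \<in> carrier (free_prod_free G n)"
  then obtain u where u: "u \<in> mixed_words G n" "x = mixed_rel G n `` {u}"
    unfolding carrier_free_prod_free by blast
  then show "eval_mixed G g x \<in> carrier G"
    using assms by (simp add: eval_mixed_class eval_word_closed)
  fix y assume "y \<in> carrier (free_prod_free G n)"
  then obtain v where v: "v \<in> mixed_words G n" "y = mixed_rel G n `` {v}"
    unfolding carrier_free_prod_free by blast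
  show "eval_mixed G g (x \<otimes>\<^bsub>free_prod_free G n\<^esub> y) = eval_mixed G g x \<otimes> eval_mixed G g y"
    using u v assms
    by (simp add: mult_free_prod_free eval_mixed_class eval_word_append[OF _ _ assms])
qed

lemma eval_mixed_Const:
  assumes "a \<in> carrier G" "g \<in> {..<n} \<rightarrow> carrier G"
  shows "eval_mixed G g (mixed_rel G n `` {[Const a]}) = a"
  using assms by (simp add: eval_mixed_class eval_word_def)

lemma eval_mixed_Gen:
  assumes "i < n" "g \<in> {..<n} \<rightarrow> carrier G"
  shows "eval_mixed G g (mixed_rel G n `` {[Gen i True]}) = g i"
proof -
  have "g i \<in> carrier G" using assms by auto
  then show ?thesis using assms by (simp add: eval_mixed_class eval_word_def)
qed

end


section \<open>Actions on probability spaces\<close>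

definition ae_faithful ::
    "('g, 'r) monoid_scheme \<Rightarrow> 'x measure \<Rightarrow> ('g \<Rightarrow> 'x \<Rightarrow> 'x) \<Rightarrow> bool" where
  "ae_faithful G M act \<longleftrightarrow> (\<forall>g\<in>carrier G - {\<one>\<^bsub>G\<^esub>}. \<not> (AE x in M. act g x = x))"

definition ergodic_action ::
    "('g, 'r) monoid_scheme \<Rightarrow> 'x measure \<Rightarrow> ('g \<Rightarrow> 'x \<Rightarrow> 'x) \<Rightarrow> bool" where
  "ergodic_action G M act \<longleftrightarrow>
    (\<forall>A\<in>sets M. (\<forall>g\<in>carrier G. act g ` A = A) \<longrightarrow> emeasure M A = 0 \<or> emeasure M A = 1)"

definition essentially_free ::
    "('g, 'r) monoid_scheme \<Rightarrow> 'x measure \<Rightarrow> ('g \<Rightarrow> 'x \<Rightarrow> 'x) \<Rightarrow> bool" where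
  "essentially_free G M act \<longleftrightarrow>
    (\<forall>g\<in>carrier G - {\<one>\<^bsub>G\<^esub>}. {x\<in>space M. act g x = x} \<in> null_sets M)"


section \<open>Generalized Bernoulli actions\<close>

definition borel_of :: "'a topology \<Rightarrow> 'a measure" where
  "borel_of T = sigma (topspace T) {U. openin T U}"

definition standard_borel :: "'a measure \<Rightarrow> bool" where
  "standard_borel M \<longleftrightarrow>
    (\<exists>T. completely_metrizable_space T \<and> second_countable T \<and>
      space M = topspace T \<and> sets M = sets (borel_of T))"

definition nontrivial_standard_prob_space :: "'a measure \<Rightarrow> bool" where
  "nontrivial_standard_prob_space M \<longleftrightarrow>
    prob_space M \<and> standard_borel M \<and> \<not> (\<exists>p\<in>space M. AE x in M. x = p)"

definition bernoulli_space :: "'i set \<Rightarrow> 'a measure \<Rightarrow> ('i \<Rightarrow> 'a) measure" where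
  "bernoulli_space I M0 = PiM I (\<lambda>_. M0)"

definition bernoulli_action ::
    "('g, 'r) monoid_scheme \<Rightarrow> 'i set \<Rightarrow> ('g \<Rightarrow> 'i \<Rightarrow> 'i) \<Rightarrow> 'a measure
      \<Rightarrow> 'g \<Rightarrow> ('i \<Rightarrow> 'a) \<Rightarrow> ('i \<Rightarrow> 'a)" where
  "bernoulli_action G I \<phi> M0 g = (\<lambda>x\<in>space (bernoulli_space I M0). \<lambda>i\<in>I. x (\<phi> (inv\<^bsub>G\<^esub> g) i))"

lemma (in group_action) bernoulli_action_group_action:
  "group_action G (space (bernoulli_space E M0)) (bernoulli_action G E \<phi> M0)"
proof -
  let ?S = "space (bernoulli_space E M0)" and ?a = "bernoulli_action G E \<phi> M0"
  have S: "?S = (\<Pi>\<^sub>E i\<in>E. space M0)" by (simp add: bernoulli_space_def space_PiM)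
  interpret G: group G using group_hom by (simp add: group_hom_def)
  have app: "?a g x i = x (\<phi> (inv g) i)" if "x \<in> ?S" "i \<in> E" for g x i
    using that by (simp add: bernoulli_action_def)
  have out: "?a g x i = undefined" if "x \<in> ?S" "i \<notin> E" for g x i
    using that by (simp add: bernoulli_action_def)
  have S_out: "x i = undefined" if "x \<in> ?S" "i \<notin> E" for x i
    using that by (simp add: S PiE_def extensional_def)
  have mem: "\<phi> (inv g) i \<in> E" if "g \<in> carrier G" "i \<in> E" for g i
    using element_image[of "inv g" i] that by simp
  have closed: "?a g x \<in> ?S" if "g \<in> carrier G" "x \<in> ?S" for g x
  proof -
    have "?a g x i \<in> space M0" if "i \<in> E" for i
      using app[OF \<open>x \<in> ?S\<close> that] mem[OF \<open>g \<in> carrier G\<close> that] \<open>x \<in> ?S\<close>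
        PiE_mem[of x E "\<lambda>_. space M0"] by (simp add: S)
    moreover have "?a g x \<in> extensional E"
      using out[OF \<open>x \<in> ?S\<close>] by (simp add: extensional_def)
    ultimately show ?thesis unfolding S by (simp add: PiE_iff)
  qed
  have comp: "?a (g \<otimes> h) x = ?a g (?a h x)"
    if g: "g \<in> carrier G" and h: "h \<in> carrier G" and x: "x \<in> ?S" for g h x
  proof
    fix i show "?a (g \<otimes> h) x i = ?a g (?a h x) i"
    proof (cases "i \<in> E")
      case True
      have "\<phi> (inv (g \<otimes> h)) i = \<phi> (inv h) (\<phi> (inv g) i)"
        using g h composition_rule[OF True, of "inv h" "inv g"] by (simp add: G.inv_mult_group)
      then show ?thesis
        using app[OF x True] app[OF closed[OF h x] True] app[OF x mem[OF g True]] by simp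
    qed (use out x closed[OF h x] in simp)
  qed
  have unit: "?a \<one> x = x" if x: "x \<in> ?S" for x
  proof
    fix i show "?a \<one> x i = x i"
    proof (cases "i \<in> E")
      case True
      have "\<phi> \<one> i = i" using fun_cong[OF id_eq_one, of i] True by simp
      then show ?thesis using app[OF x True] by simp
    qed (simp add: out[OF x] S_out[OF x])
  qed
  have inverse: "?a (inv g) (?a g x) = x" "?a g (?a (inv g) x) = x"
    if "g \<in> carrier G" "x \<in> ?S" for g x
    using that comp[of "inv g" g x] comp[of g "inv g" x] unit by auto
  have bij: "?a g \<in> Bij ?S" if g: "g \<in> carrier G" for g
    unfolding Bij_def
  proof (intro IntI CollectI)
    show "?a g \<in> extensional ?S" by (auto simp: bernoulli_action_def)
    show "bij_betw (?a g) ?S ?S"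
      by (rule bij_betw_byWitness[where f' = "?a (inv g)"]) (use g inverse closed in auto)
  qed
  show ?thesis
    unfolding group_action_def group_hom_def group_hom_axioms_def
  proof (intro conjI homI)
    fix g h assume gh: "g \<in> carrier G" "h \<in> carrier G"
    show "?a (g \<otimes> h) = ?a g \<otimes>\<^bsub>BijGroup ?S\<^esub> ?a h"
    proof
      fix x show "?a (g \<otimes> h) x = (?a g \<otimes>\<^bsub>BijGroup ?S\<^esub> ?a h) x"
        using gh bij comp by (cases "x \<in> ?S")
          (auto simp: BijGroup_def compose_def bernoulli_action_def)
    qed
  qed (use bij group_BijGroup in \<open>auto simp: BijGroup_def G.group_axioms\<close>)
qed


section \<open>Affine actions on compact abelian groups\<close>

definition compact_abelian_group :: "('k, 's) monoid_scheme \<Rightarrow> 'k topology \<Rightarrow> bool" where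
  "compact_abelian_group K T \<longleftrightarrow>
    comm_group K \<and> topspace T = carrier K \<and> compact_space T \<and> Hausdorff_space T \<and>
    continuous_map (prod_topology T T) T (\<lambda>(x, y). x \<otimes>\<^bsub>K\<^esub> y) \<and>
    continuous_map T T (\<lambda>x. inv\<^bsub>K\<^esub> x)"

text \<open>
  \<open>K\<close> need not be metrizable, so regularity, which makes Haar measure unique, is part of the
  definition.
\<close>

definition normalized_haar :: "('k, 's) monoid_scheme \<Rightarrow> 'k topology \<Rightarrow> 'k measure \<Rightarrow> bool" where
  "normalized_haar K T M \<longleftrightarrow>
    space M = topspace T \<and> sets M = sets (borel_of T) \<and> prob_space M \<and>
    (\<forall>a\<in>carrier K. \<forall>A\<in>sets M. emeasure M (a <#\<^bsub>K\<^esub> A) = emeasure M A) \<and>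
    (\<forall>A\<in>sets M. emeasure M A = (INF U\<in>{U. openin T U \<and> A \<subseteq> U}. emeasure M U)) \<and>
    (\<forall>U. openin T U \<longrightarrow> emeasure M U = (SUP C\<in>{C. compactin T C \<and> C \<subseteq> U}. emeasure M C))"

definition affine_action ::
    "('g, 'r) monoid_scheme \<Rightarrow> ('k, 's) monoid_scheme \<Rightarrow> 'k topology
      \<Rightarrow> ('g \<Rightarrow> 'k \<Rightarrow> 'k) \<Rightarrow> bool" where
  "affine_action G K T act \<longleftrightarrow>
    group_action G (carrier K) act \<and>
    (\<forall>g\<in>carrier G. \<exists>b\<in>carrier K. \<exists>\<alpha>. \<alpha> \<in> iso K K \<and> continuous_map T T \<alpha> \<and>
      (\<forall>k\<in>carrier K. act g k = b \<otimes>\<^bsub>K\<^esub> \<alpha> k))"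

end

theory Submission
  imports Defs
begin

text \<open>
  If \<open>g\<close> has a non-null fixed point set, then there is an \<open>n\<close> such that, for every \<open>h\<close>, each point
  lies in a set of at most \<open>n\<close> points invariant under both \<open>g\<close> and \<open>h g h\<inverse>\<close>. Hence
  \<open>(g h g h\<inverse>) ^ n!\<close> acts trivially, so it is \<open>1\<close> by faithfulness, and for \<open>g \<noteq> 1\<close> the word
  \<open>(g x g x\<inverse>) ^ n!\<close> is a mixed identity. In the Bernoulli case, points are elements of
  the index set, where a non-null fixed point set forces \<open>g\<close> to have finite support. In
  the affine case with linear part \<open>\<alpha>\<close>, the elements \<open>\<alpha>(k) k\<inverse>\<close> form a finite group \<open>L\<close>,
  and the invariant sets are the translates of \<open>L \<beta>(L)\<close>, where \<open>\<beta>\<close> is the linear part of \<open>h\<close>.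
\<close>

section \<open>A nontrivial word\<close>

definition conj_pow_word :: "'g \<Rightarrow> nat \<Rightarrow> 'g letter list" where
  "conj_pow_word g N = concat (replicate N [Const g, Gen 0 True, Const g, Gen 0 False])"

lemma conj_pow_word_Suc:
  "conj_pow_word g (Suc N) = [Const g, Gen 0 True, Const g, Gen 0 False] @ conj_pow_word g N"
  by (simp add: conj_pow_word_def)

text \<open>
  Nontriviality is witnessed by an action on \<open>G \<times> \<nat>\<close>: constants multiply the first component, and
  every generator acts by the involution exchanging \<open>(g, n)\<close> and \<open>(1, n + 1)\<close>, so that
  \<open>g x\<close> maps \<open>(g, n)\<close> to \<open>(g, n + 1)\<close>.
\<close>

fun ladder_letter :: "('g, 'r) monoid_scheme \<Rightarrow> 'g \<Rightarrow> 'g letter \<Rightarrow> 'g \<times> nat \<Rightarrow> 'g \<times> nat" where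
  "ladder_letter G g (Const a) (b, n) = (a \<otimes>\<^bsub>G\<^esub> b, n)"
| "ladder_letter G g (Gen i s) (b, n) =
    (if b = g then (\<one>\<^bsub>G\<^esub>, Suc n) else if b = \<one>\<^bsub>G\<^esub> \<and> n > 0 then (g, n - 1) else (b, n))"

definition ladder_word :: "('g, 'r) monoid_scheme \<Rightarrow> 'g \<Rightarrow> 'g letter list \<Rightarrow> 'g \<times> nat \<Rightarrow> 'g \<times> nat" where
  "ladder_word G g u = foldr (ladder_letter G g) u"

lemma ladder_word_append: "ladder_word G g (u @ v) p = ladder_word G g u (ladder_word G g v p)"
  by (simp add: ladder_word_def)

context group
begin

lemma ladder_word_closed:
  assumes "g \<in> carrier G" "u \<in> mixed_words G n" "p \<in> carrier G \<times> UNIV"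
  shows "ladder_word G g u p \<in> carrier G \<times> UNIV"
  using assms(2)
proof (induction u)
  case Nil
  then show ?case using assms(3) by (simp add: ladder_word_def)
next
  case (Cons l u)
  have "u \<in> mixed_words G n"
    using Cons.prems append_mixed_words[of "[l]" u G n] by simp
  with Cons.IH obtain b m where "ladder_word G g u p = (b, m)" "b \<in> carrier G" by auto
  then show ?case using Cons.prems assms(1) by (cases l) (auto simp: ladder_word_def)
qed

text \<open>The multiplication and unit relations hold by the group laws in the first component. For
  cancellation, both signs of a generator act by the same map, and \<open>g \<noteq> \<one>\<close>
  makes that map an involution.\<close>

lemma ladder_word_mixed_eq:
  assumes "mixed_eq G n u v" "g \<in> carrier G" "g \<noteq> \<one>" "p \<in> carrier G \<times> UNIV"
  shows "ladder_word G g u p = ladder_word G g v p"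
  using assms
proof (induction arbitrary: p rule: mixed_eq.induct)
  case (mult u v a b)
  then obtain c m where "ladder_word G g v p = (c, m)" "c \<in> carrier G"
    using ladder_word_closed[of g v n p] by auto
  with mult show ?case
    by (simp only: ladder_word_append) (simp add: ladder_word_def m_assoc)
next
  case (unit u v)
  then obtain c m where "ladder_word G g v p = (c, m)" "c \<in> carrier G"
    using ladder_word_closed[of g v n p] by auto
  then show ?case by (simp only: ladder_word_append) (simp add: ladder_word_def)
next
  case (cancel u v i b)
  obtain c m where "ladder_word G g v p = (c, m)" by fastforce
  with cancel show ?case by (simp only: ladder_word_append) (auto simp: ladder_word_def)
qed auto

lemma ladder_word_conj_pow:
  assumes "g \<in> carrier G" "g \<noteq> \<one>"
  shows "ladder_word G g (conj_pow_word g N) (g, 0) = (g, 2 * N)"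
proof -
  \<comment> \<open>Reading from the right, each \<open>Gen\<close> sends \<open>(g, m)\<close> to
    \<open>(\<one>, m + 1)\<close> and the next \<open>Const g\<close> turns this into
    \<open>(g, m + 1)\<close>; a block contains two such pairs.\<close>
  have step: "ladder_word G g [Const g, Gen 0 True, Const g, Gen 0 False] (g, m) = (g, m + 2)" for m
    using assms by (simp add: ladder_word_def)
  show ?thesis
    by (induction N)
      (simp_all only: conj_pow_word_Suc ladder_word_append step,
       simp_all add: conj_pow_word_def ladder_word_def)
qed

lemma conj_pow_word_mixed_words:
  "g \<in> carrier G \<Longrightarrow> conj_pow_word g N \<in> mixed_words G 1"
  by (induction N) (simp_all add: conj_pow_word_Suc, simp add: conj_pow_word_def)

text \<open>The empty word fixes \<open>(g, 0)\<close>, while the power lifts it to level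
  \<open>2 * N > 0\<close>.\<close>

lemma conj_pow_word_nontrivial:
  assumes "g \<in> carrier G" "g \<noteq> \<one>" "N > 0"
  shows "\<not> mixed_eq G 1 (conj_pow_word g N) []"
proof
  assume "mixed_eq G 1 (conj_pow_word g N) []"
  from ladder_word_mixed_eq[OF this assms(1,2), of "(g, 0)"] show False
    using assms by (simp add: ladder_word_conj_pow) (simp add: ladder_word_def)
qed

section \<open>Substitution into the word\<close>

lemma eval_conj_pow_word:
  assumes "g \<in> carrier G" "h 0 \<in> carrier G"
  shows "eval_word G h (conj_pow_word g N) = (g \<otimes> (h 0 \<otimes> g \<otimes> inv (h 0))) [^] N"
proof -
  let ?a = "g \<otimes> (h 0 \<otimes> g \<otimes> inv (h 0))"
  have "eval_word G h [Const g, Gen 0 True, Const g, Gen 0 False] = ?a"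
    using assms by (simp add: eval_word_def m_assoc)
  then have step: "eval_word G h (conj_pow_word g (Suc N)) = ?a \<otimes> eval_word G h (conj_pow_word g N)"
    for N unfolding conj_pow_word_Suc using assms
    by (subst eval_word_append[where n = 1]) (auto simp: conj_pow_word_mixed_words simp del: One_nat_def)
  have "?a \<in> carrier G" using assms by simp
  then show ?thesis
  proof (induction N)
    case (Suc N)
    then show ?case by (simp only: step nat_pow_Suc2)
  qed (simp add: conj_pow_word_def eval_word_def)
qed

text \<open>The power is a nontrivial element of the free product with one variable, so some
  substitution of \<open>h\<close> for that variable gives a value other than \<open>\<one>\<close>.
  The exponent is fixed before \<open>h\<close>.\<close>

lemma MIF_conj_pow:
  assumes "MIF G" "g \<in> carrier G" "g \<noteq> \<one>" "N > (0::nat)"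
  shows "\<exists>h\<in>carrier G. (g \<otimes> (h \<otimes> g \<otimes> inv h)) [^] N \<noteq> \<one>"
proof (rule ccontr)
  assume "\<not> ?thesis"
  then have triv: "(g \<otimes> (h \<otimes> g \<otimes> inv h)) [^] N = \<one>" if "h \<in> carrier G" for h
    using that by blast
  let ?u = "conj_pow_word g N"
  let ?w = "mixed_rel G 1 `` {?u}"
  have u: "?u \<in> mixed_words G 1" by (rule conj_pow_word_mixed_words[OF assms(2)])
  have "?w \<in> carrier (free_prod_free G 1)"
    using u carrier_free_prod_free by blast
  moreover have "?w \<noteq> \<one>\<^bsub>free_prod_free G 1\<^esub>"
  proof
    assume "?w = \<one>\<^bsub>free_prod_free G 1\<^esub>"
    then have "?w = mixed_rel G 1 `` {[]}" by (simp add: free_prod_free_def)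
    then have "mixed_eq G 1 ?u []"
      using eq_equiv_class[OF _ equiv_mixed_rel, of 1 ?u "[]"] by (simp add: mixed_rel_def)
    with conj_pow_word_nontrivial assms show False by blast
  qed
  moreover have "eval_mixed G h ?w = \<one>" if "h \<in> {..<1} \<rightarrow> carrier G" for h
  proof -
    have "h 0 \<in> carrier G" using that by auto
    then show ?thesis
      using eval_mixed_class[OF u that] eval_conj_pow_word[of g h N] assms(2) triv by simp
  qed
  ultimately have "satisfies_mixed_identity G"
    unfolding satisfies_mixed_identity_def
    by (intro exI[of _ "1::nat"] conjI bexI[of _ ?w] ballI) simp_all
  with assms(1) show False by (simp add: MIF_def)
qed

end

section \<open>Actions with uniformly bounded orbits\<close>

text \<open>Among the iterates of \<open>x\<close> of order 0 to \<open>n\<close> two coincide by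
  the pigeonhole principle. Injectivity turns this into a period of \<open>x\<close> that is at most
  \<open>n\<close> and hence divides \<open>fact n\<close>.\<close>

lemma funpow_fact_fixed:
  assumes "finite S" "card S \<le> n" "f ` S \<subseteq> S" "inj_on f S" "x \<in> S"
  shows "(f ^^ fact n) x = x"
proof -
  have mem: "(f ^^ i) y \<in> S" if "y \<in> S" for i y
    using that assms(3) by (induction i) auto
  have inj: "y = z" if "(f ^^ i) y = (f ^^ i) z" "y \<in> S" "z \<in> S" for i y z
    using that assms(4) mem by (induction i) (auto dest: inj_onD)
  have "\<not> inj_on (\<lambda>i. (f ^^ i) x) {..n}"
  proof
    assume "inj_on (\<lambda>i. (f ^^ i) x) {..n}"
    then have "card {..n} \<le> card S"
      by (rule card_inj_on_le) (use mem assms in auto)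
    with assms(2) show False by simp
  qed
  then obtain i j where ij: "i < j" "j \<le> n" "(f ^^ i) x = (f ^^ j) x"
    unfolding inj_on_def by (metis atMost_iff nat_neq_iff)
  \<comment> \<open>The \<open>j\<close>-th iterate is split so that the \<open>i\<close>-th one,
    injective on \<open>S\<close>, can be cancelled.\<close>
  have "(f ^^ i) ((f ^^ (j - i)) x) = (f ^^ i) x"
    using ij funpow_add[of i "j - i" f] by (simp add: fun_eq_iff)
  then have fixed: "(f ^^ (j - i)) x = x"
    using inj mem assms(5) by blast
  have "(j - i) dvd fact n" using ij by (intro dvd_fact) auto
  then obtain c where c: "fact n = (j - i) * c" by blast
  have "((f ^^ (j - i)) ^^ c) x = x" by (induction c) (simp_all add: fixed)
  then show ?thesis by (simp only: c funpow_mult)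
qed

context group_action
begin

lemma nat_pow_action:
  assumes "a \<in> carrier G" "x \<in> E"
  shows "\<phi> (a [^] (n::nat)) x = (\<phi> a ^^ n) x"
proof -
  interpret G: group G using group_hom by (simp add: group_hom_def)
  have mem: "(\<phi> a ^^ n) x \<in> E" for n
    by (induction n) (use assms element_image in auto)
  show ?thesis
  proof (induction n)
    case 0
    then show ?case using id_eq_one assms(2) by (metis G.nat_pow_0 funpow_0 restrict_apply')
  next
    case (Suc n)
    then show ?case
      using assms composition_rule[OF assms(2), of a "a [^] n"]
      by (simp only: G.nat_pow_Suc2) simp
  qed
qed

text \<open>Common core of both cases. \<open>S\<close> may depend on \<open>h\<close> and
  \<open>x\<close>, but \<open>n\<close> may not, since the exponent \<open>fact n\<close> is chosen
  before \<open>MIF G\<close> supplies \<open>h\<close>. The product of \<open>g\<close> and its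
  conjugate maps \<open>S\<close> injectively into itself, so its power fixes every point.\<close>

lemma MIF_bounded_orbits:
  assumes "MIF G" and g: "g \<in> carrier G"
    and faithful: "\<And>u. \<lbrakk>u \<in> carrier G; \<And>x. x \<in> E \<Longrightarrow> \<phi> u x = x\<rbrakk> \<Longrightarrow> u = \<one>"
    and bounded: "\<And>h x. \<lbrakk>h \<in> carrier G; x \<in> E\<rbrakk> \<Longrightarrow> \<exists>S. finite S \<and> card S \<le> n \<and> x \<in> S \<and> S \<subseteq> E \<and>
      \<phi> g ` S \<subseteq> S \<and> \<phi> (h \<otimes> g \<otimes> inv h) ` S \<subseteq> S"
  shows "g = \<one>"
proof (rule ccontr)
  assume "g \<noteq> \<one>"
  interpret G: group G using group_hom by (simp add: group_hom_def)
  obtain h where h: "h \<in> carrier G" "(g \<otimes> (h \<otimes> g \<otimes> inv h)) [^] (fact n :: nat) \<noteq> \<one>"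
    using G.MIF_conj_pow[OF assms(1) g \<open>g \<noteq> \<one>\<close>, of "fact n"] by auto
  let ?a = "g \<otimes> (h \<otimes> g \<otimes> inv h)"
  have a: "?a \<in> carrier G" using g h by simp
  have "\<phi> (?a [^] (fact n :: nat)) x = x" if x: "x \<in> E" for x
  proof -
    obtain S where S: "finite S" "card S \<le> n" "x \<in> S" "S \<subseteq> E" "\<phi> g ` S \<subseteq> S"
      "\<phi> (h \<otimes> g \<otimes> inv h) ` S \<subseteq> S"
      using bounded[OF h(1) x] by blast
    have "\<phi> ?a y \<in> S" if "y \<in> S" for y
    proof -
      have "\<phi> ?a y = \<phi> g (\<phi> (h \<otimes> g \<otimes> inv h) y)"
        using composition_rule[of y g "h \<otimes> g \<otimes> inv h"] that S(4) g h by auto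
      then show ?thesis using S(5,6) that by auto
    qed
    then have "(\<phi> ?a ^^ fact n) x = x"
      using S inj_on_subset[OF inj_prop[OF a] S(4)] by (intro funpow_fact_fixed[of S]) auto
    then show ?thesis using nat_pow_action[OF a x] by simp
  qed
  then show False using faithful[of "?a [^] (fact n :: nat)"] a h(2) by simp
qed

text \<open>A permutation preserves its support and fixes all other points, and the support of
  \<open>h g h\<inverse>\<close> is the image under \<open>h\<close> of the support of
  \<open>g\<close>. If these are finite, their union with \<open>x\<close> adjoined is invariant and
  of size bounded independently of \<open>h\<close>.\<close>

lemma MIF_infinite_support:
  assumes "MIF G" and g: "g \<in> carrier G" "g \<noteq> \<one>"
    and faithful: "\<And>u. \<lbrakk>u \<in> carrier G; \<And>x. x \<in> E \<Longrightarrow> \<phi> u x = x\<rbrakk> \<Longrightarrow> u = \<one>"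
  shows "infinite {x \<in> E. \<phi> g x \<noteq> x}"
proof
  interpret G: group G using group_hom by (simp add: group_hom_def)
  define F where "F = {x \<in> E. \<phi> g x \<noteq> x}"
  assume "finite {x \<in> E. \<phi> g x \<noteq> x}"
  then have fin: "finite F" by (simp add: F_def)
  have "g = \<one>"
  proof (rule MIF_bounded_orbits[OF assms(1) g(1) faithful, where n = "2 * card F + 1"])
    fix h x assume h: "h \<in> carrier G" and x: "x \<in> E"
    let ?g' = "h \<otimes> g \<otimes> inv h"
    have conj: "\<phi> ?g' (\<phi> h y) = \<phi> h (\<phi> g y)" if "y \<in> E" for y
    proof -
      have "\<phi> ?g' (\<phi> h y) = \<phi> (?g' \<otimes> h) y"
        using composition_rule[OF that, of ?g' h] g h by simp
      also have "?g' \<otimes> h = h \<otimes> g" using g h by (simp add: G.m_assoc)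
      finally show ?thesis using composition_rule[OF that, of h g] g h by simp
    qed
    \<comment> \<open>If \<open>\<phi> g y\<close> were fixed by \<open>g\<close>, injectivity would
      give \<open>\<phi> g y = y\<close>.\<close>
    have F_mem: "\<phi> g y \<in> F" if "y \<in> F" for y
      using that element_image[OF g(1)] inj_onD[OF inj_prop[OF g(1)], of "\<phi> g y" y]
      by (auto simp: F_def)
    have F'_mem: "\<phi> ?g' y \<in> \<phi> h ` F" if y: "y \<in> \<phi> h ` F" for y
    proof -
      obtain z where z: "z \<in> F" "y = \<phi> h z" using y by blast
      then have "\<phi> ?g' y = \<phi> h (\<phi> g z)" using conj[of z] by (simp add: F_def)
      then show ?thesis using F_mem[OF z(1)] by blast
    qed
    have out': "\<phi> ?g' y = y" if y: "y \<in> E" "y \<notin> \<phi> h ` F" for y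
    proof -
      obtain z where z: "z \<in> E" "y = \<phi> h z" using surj_prop[OF h] y(1) by blast
      then have "\<phi> g z = z" using y(2) by (auto simp: F_def)
      then show ?thesis using conj[OF z(1)] z(2) by simp
    qed
    \<comment> \<open>The point \<open>x\<close> may lie outside both supports; it accounts for the
      1 in \<open>2 * card F + 1\<close>.\<close>
    let ?S = "insert x (F \<union> \<phi> h ` F)"
    have S: "?S \<subseteq> E" using x element_image[OF h] by (auto simp: F_def)
    have "card ?S \<le> Suc (card (F \<union> \<phi> h ` F))"
      using fin by (simp add: card_insert_if)
    also have "\<dots> \<le> Suc (card F + card (\<phi> h ` F))"
      by (simp add: card_Un_le)
    also have "\<dots> \<le> 2 * card F + 1" using card_image_le[OF fin, of "\<phi> h"] by simp
    finally have "card ?S \<le> 2 * card F + 1" .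
    moreover have "\<phi> g y \<in> ?S" if "y \<in> ?S" for y
    proof (cases "y \<in> F")
      case False
      then have "\<phi> g y = y" using S that unfolding F_def by blast
      then show ?thesis using that by simp
    qed (use F_mem in blast)
    moreover have "\<phi> ?g' y \<in> ?S" if "y \<in> ?S" for y
    proof (cases "y \<in> \<phi> h ` F")
      case False
      then have "\<phi> ?g' y = y" using S that out'[of y] by blast
      then show ?thesis using that by simp
    qed (use F'_mem in blast)
    ultimately show "\<exists>S. finite S \<and> card S \<le> 2 * card F + 1 \<and> x \<in> S \<and> S \<subseteq> E \<and>
        \<phi> g ` S \<subseteq> S \<and> \<phi> ?g' ` S \<subseteq> S"
      using fin S by (intro exI[of _ ?S]) blast
  qed
  with g(2) show False by contradiction
qed

end

section \<open>Generalized Bernoulli actions\<close>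

text \<open>A countable base of a Hausdorff space separates points. This replaces equality of points
  by countably many measurable conditions.\<close>

lemma standard_borel_separating:
  assumes "standard_borel M"
  obtains \<B> where "countable \<B>" "\<B> \<subseteq> sets M"
    "\<And>x y. \<lbrakk>x \<in> space M; y \<in> space M; \<And>B. B \<in> \<B> \<Longrightarrow> x \<in> B \<longleftrightarrow> y \<in> B\<rbrakk> \<Longrightarrow> x = y"
proof -
  obtain T where T: "completely_metrizable_space T" "second_countable T" "space M = topspace T"
    "sets M = sets (borel_of T)"
    using assms by (auto simp: standard_borel_def)
  have open_sets: "openin T U \<Longrightarrow> U \<in> sets M" for U
    unfolding T(4) borel_of_def using openin_subset by (subst sets_measure_of) auto
  have "Hausdorff_space T"
    using T(1) completely_metrizable_imp_metrizable_space metrizable_imp_Hausdorff_space by blast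
  obtain \<B> where \<B>: "countable \<B>" "\<And>V. V \<in> \<B> \<Longrightarrow> openin T V"
    "\<And>U x. openin T U \<Longrightarrow> x \<in> U \<Longrightarrow> \<exists>V\<in>\<B>. x \<in> V \<and> V \<subseteq> U"
    using T(2) unfolding second_countable_def by metis
  show ?thesis
  proof
    show "countable \<B>" "\<B> \<subseteq> sets M" using \<B> open_sets by auto
    fix x y assume xy: "x \<in> space M" "y \<in> space M" "\<And>B. B \<in> \<B> \<Longrightarrow> x \<in> B \<longleftrightarrow> y \<in> B"
    show "x = y"
    proof (rule ccontr)
      assume "x \<noteq> y"
      then obtain U V where "openin T U" "openin T V" "x \<in> U" "y \<in> V" "disjnt U V"
        using \<open>Hausdorff_space T\<close> xy(1,2) T(3) unfolding Hausdorff_space_def by metis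
      then show False using \<B>(3)[of U x] xy(3) by (meson disjnt_iff subsetD)
    qed
  qed
qed

text \<open>If all events had measure 0 or 1, membership in each set of a countable separating
  family would be almost surely constant, and the measure would be concentrated on a single
  point.\<close>

lemma nontrivial_standard_prob_space_event:
  assumes "nontrivial_standard_prob_space M"
  obtains A where "A \<in> sets M" "0 < measure M A" "measure M A < 1"
proof (rule ccontr)
  note that' = that
  assume no: "\<not> thesis"
  interpret prob_space M using assms by (simp add: nontrivial_standard_prob_space_def)
  have zero_one: "prob A = 0 \<or> prob A = 1" if "A \<in> events" for A
    using no that' that zero_less_measure_iff prob_le_1[of A] by (metis less_le)
  obtain \<B> where \<B>: "countable \<B>" "\<B> \<subseteq> events"
    "\<And>x y. \<lbrakk>x \<in> space M; y \<in> space M; \<And>B. B \<in> \<B> \<Longrightarrow> x \<in> B \<longleftrightarrow> y \<in> B\<rbrakk> \<Longrightarrow> x = y"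
    using assms standard_borel_separating unfolding nontrivial_standard_prob_space_def by metis
  have "AE x in M. x \<in> B \<longleftrightarrow> prob B = 1" if "B \<in> \<B>" for B
  proof -
    have "B \<in> events" using that \<B> by blast
    with zero_one[OF this] show ?thesis using prob_eq_0[of B] AE_in_set_eq_1[of B] by auto
  qed
  then have ae: "AE x in M. \<forall>B\<in>\<B>. x \<in> B \<longleftrightarrow> prob B = 1"
    using \<B>(1) by (intro AE_ball_countable')
  \<comment> \<open>A property that holds almost everywhere in a probability space holds at some
    point. By separation \<open>p\<close> is the only such point.\<close>
  then have "\<exists>p\<in>space M. \<forall>B\<in>\<B>. p \<in> B \<longleftrightarrow> prob B = 1"
  proof -
    have False if "\<not> ?thesis"
    proof (rule AE_contr[OF ae])
      show "AE x in M. \<not> (\<forall>B\<in>\<B>. x \<in> B \<longleftrightarrow> prob B = 1)" by (rule AE_I2) (use that in blast)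
    qed
    then show ?thesis by blast
  qed
  then obtain p where p: "p \<in> space M" "\<forall>B\<in>\<B>. p \<in> B \<longleftrightarrow> prob B = 1" by blast
  have "AE x in M. x = p"
    using ae AE_space by eventually_elim (use p \<B>(3) in auto)
  then show False using assms p(1) by (auto simp: nontrivial_standard_prob_space_def)
qed

section \<open>Independence of disjoint coordinate pairs\<close>

lemma sets_PiM_pairs:
  assumes "A \<in> sets M" "finite J" "finite J'" "J \<union> J' \<subseteq> I" "f ` (J \<union> J') \<subseteq> I"
  shows "{x \<in> space (PiM I (\<lambda>_. M)). (\<forall>i\<in>J. \<not> (x i \<in> A \<and> x (f i) \<notin> A)) \<and>
      (\<forall>i\<in>J'. x i \<in> A \<and> x (f i) \<notin> A)} \<in> sets (PiM I (\<lambda>_. M))"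
proof -
  have coord: "{x \<in> space (PiM I (\<lambda>_. M)). x i \<in> A} \<in> sets (PiM I (\<lambda>_. M))" if "i \<in> I" for i
    using that assms(1) by measurable
  have pair: "{x \<in> space (PiM I (\<lambda>_. M)). x i \<in> A \<and> x (f i) \<notin> A} \<in> sets (PiM I (\<lambda>_. M))"
    if "i \<in> J \<union> J'" for i
    using that coord[of i] coord[of "f i"] assms(4,5)
    by (intro sets.sets_Collect_conj sets.sets_Collect_neg) auto
  show ?thesis
  proof (rule sets.sets_Collect_conj)
    show "{x \<in> space (PiM I (\<lambda>_. M)). \<forall>i\<in>J'. x i \<in> A \<and> x (f i) \<notin> A} \<in> sets (PiM I (\<lambda>_. M))"
      using assms(3) by (intro sets.sets_Collect_countable_All' pair) (auto intro: countable_finite)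
    show "{x \<in> space (PiM I (\<lambda>_. M)). \<forall>i\<in>J. \<not> (x i \<in> A \<and> x (f i) \<notin> A)} \<in> sets (PiM I (\<lambda>_. M))"
      using assms(2)
      by (intro sets.sets_Collect_countable_All' sets.sets_Collect_neg pair)
        (auto intro: countable_finite)
  qed
qed

text \<open>
  For pairwise distinct coordinates \<open>i, f i\<close> (\<open>i \<in> J \<union> J'\<close>), the events
  \<open>x i \<in> A, x (f i) \<notin> A\<close> are independent; the induction removes a complement by subtraction.
\<close>

lemma (in prob_space) measure_PiM_disjoint_pairs:
  assumes A: "A \<in> events"
    and "finite J" "finite J'" "J \<inter> J' = {}" "J \<union> J' \<subseteq> I" "f ` (J \<union> J') \<subseteq> I"
    and "inj_on f (J \<union> J')" "(J \<union> J') \<inter> f ` (J \<union> J') = {}"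
    and r: "r = prob A * (1 - prob A)"
  shows "measure (PiM I (\<lambda>_. M)) {x \<in> space (PiM I (\<lambda>_. M)).
      (\<forall>i\<in>J. \<not> (x i \<in> A \<and> x (f i) \<notin> A)) \<and> (\<forall>i\<in>J'. x i \<in> A \<and> x (f i) \<notin> A)}
    = (1 - r) ^ card J * r ^ card J'"
  using assms(2-8)
proof (induction J arbitrary: J' rule: finite_induct)
  case empty
  let ?P = "PiM I (\<lambda>_. M)"
  interpret P: product_prob_space "\<lambda>_. M" I
    by (intro product_prob_spaceI prob_space_axioms)
  \<comment> \<open>\<open>J'\<close> is disjoint from its image under \<open>f\<close>, so a single
    function of the index records both the demand \<open>A\<close> on \<open>J'\<close> and its
    complement on the image. The event becomes a cylinder over distinct coordinates.\<close>
  let ?X = "\<lambda>i. if i \<in> J' then A else space M - A"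
  have space: "x i \<in> space M" if "x \<in> space ?P" "i \<in> I" for x i
    using that by (auto simp: space_PiM)
  have eq: "{x \<in> space ?P. \<forall>i\<in>J'. x i \<in> A \<and> x (f i) \<notin> A} =
      {x \<in> space ?P. \<forall>i\<in>J' \<union> f ` J'. x i \<in> ?X i}" (is "?E = _")
  proof (intro Collect_cong conj_cong refl)
    fix x assume x: "x \<in> space ?P"
    have "f i \<in> I" "f i \<notin> J'" if "i \<in> J'" for i using that empty.prems by auto
    with space[OF x] show "(\<forall>i\<in>J'. x i \<in> A \<and> x (f i) \<notin> A) \<longleftrightarrow> (\<forall>i\<in>J' \<union> f ` J'. x i \<in> ?X i)"
      by (simp add: ball_Un) blast
  qed simp
  have "emeasure ?P ?E = (\<Prod>i\<in>J' \<union> f ` J'. emeasure M (?X i))"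
    unfolding eq using empty.prems A by (intro P.emeasure_PiM_Collect) auto
  also have "\<dots> = ennreal (\<Prod>i\<in>J' \<union> f ` J'. prob (?X i))"
    by (simp add: emeasure_eq_measure prod_ennreal)
  finally have "measure ?P ?E = (\<Prod>i\<in>J' \<union> f ` J'. prob (?X i))"
    by (simp add: P.emeasure_eq_measure prod_nonneg)
  also have "\<dots> = (\<Prod>i\<in>J'. prob (?X i)) * (\<Prod>i\<in>f ` J'. prob (?X i))"
    using empty.prems by (intro prod.union_disjoint) auto
  also have "(\<Prod>i\<in>J'. prob (?X i)) = prob A ^ card J'" by simp
  also have "(\<Prod>i\<in>f ` J'. prob (?X i)) = (\<Prod>i\<in>f ` J'. 1 - prob A)"
    using empty.prems A by (intro prod.cong refl) (auto simp: prob_compl)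
  also have "\<dots> = (1 - prob A) ^ card J'"
    using empty.prems by (simp add: card_image)
  finally show ?case by (simp add: r power_mult_distrib)
next
  case (insert j J)
  let ?P = "PiM I (\<lambda>_. M)"
  interpret P: product_prob_space "\<lambda>_. M" I
    by (intro product_prob_spaceI prob_space_axioms)
  let ?D = "\<lambda>i x. x i \<in> A \<and> x (f i) \<notin> A"
  let ?E = "\<lambda>J J'. {x \<in> space ?P. (\<forall>i\<in>J. \<not> ?D i x) \<and> (\<forall>i\<in>J'. ?D i x)}"
  \<comment> \<open>Moving \<open>j\<close> to the second index set keeps the union, so the
    distinctness hypotheses carry over to the subtracted event.\<close>
  have union: "J \<union> insert j J' = insert j J \<union> J'" by auto
  have "?E (insert j J) J' = ?E J J' - ?E J (insert j J')" by auto
  moreover have "?E J J' \<in> P.events"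
    by (rule sets_PiM_pairs[OF A]) (use insert in auto)
  moreover have "?E J (insert j J') \<in> P.events"
    by (rule sets_PiM_pairs[OF A]) (use insert in auto)
  ultimately have "measure ?P (?E (insert j J) J') =
      measure ?P (?E J J') - measure ?P (?E J (insert j J'))"
    by (simp only:) (rule P.finite_measure_Diff, auto)
  also have "measure ?P (?E J J') = (1 - r) ^ card J * r ^ card J'"
    using insert.prems by (intro insert.IH) (auto intro: inj_on_subset)
  also have "measure ?P (?E J (insert j J')) = (1 - r) ^ card J * r ^ card (insert j J')"
    using insert.prems insert.hyps by (intro insert.IH) (simp_all only: union, auto)
  also have "card (insert j J') = Suc (card J')" using insert by auto
  finally show ?case using insert.hyps by (simp add: algebra_simps)
qed

text \<open>Greedy choice: a new index avoids \<open>J\<close>, its image and its preimage under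
  \<open>f\<close>, the last being finite by injectivity.\<close>

lemma finite_disjoint_subset:
  assumes "infinite S" "inj_on f S" "\<And>i. i \<in> S \<Longrightarrow> f i \<noteq> i"
  shows "\<exists>J\<subseteq>S. finite J \<and> card J = n \<and> J \<inter> f ` J = {}"
proof (induction n)
  case 0
  then show ?case by (intro exI[of _ "{}"]) auto
next
  case (Suc n)
  then obtain J where J: "J \<subseteq> S" "finite J" "card J = n" "J \<inter> f ` J = {}" by blast
  have "finite (f -` J \<inter> S)" using J(2) assms(2) by (rule finite_vimage_IntI)
  then have "infinite (S - (J \<union> f ` J \<union> (f -` J \<inter> S)))"
    using J(2) assms(1) by (intro Diff_infinite_finite) auto
  then obtain i where "i \<in> S - (J \<union> f ` J \<union> (f -` J \<inter> S))"
    using infinite_imp_nonempty by blast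
  then show ?case using J assms(3) by (intro exI[of _ "insert i J"]) auto
qed

section \<open>Null fixed point sets for Bernoulli actions\<close>

text \<open>A fixed point never has \<open>x i \<in> A\<close> and
  \<open>x (f i) \<notin> A\<close>. For \<open>f i \<noteq> i\<close> this event has probability
  \<open>r > 0\<close>, and \<open>n\<close> disjoint pairs give independent events, so the fixed
  point set has measure at most \<open>(1 - r) ^ n\<close> for every \<open>n\<close>.\<close>

lemma bernoulli_fixed_points_null:
  fixes I :: "'i set"
  assumes M0: "nontrivial_standard_prob_space M0" and "countable I"
    and f: "f ` I \<subseteq> I" "inj_on f I" and inf: "infinite {i \<in> I. f i \<noteq> i}"
  shows "{x \<in> space (bernoulli_space I M0). \<forall>i\<in>I. x (f i) = x i} \<in> null_sets (bernoulli_space I M0)"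
    (is "?F \<in> _")
proof -
  interpret M0: prob_space M0 using M0 by (simp add: nontrivial_standard_prob_space_def)
  interpret P: product_prob_space "\<lambda>_. M0" I
    by (intro product_prob_spaceI M0.prob_space_axioms)
  let ?P = "PiM I (\<lambda>_. M0)"
  obtain \<B> where \<B>: "countable \<B>" "\<B> \<subseteq> sets M0"
    "\<And>x y. \<lbrakk>x \<in> space M0; y \<in> space M0; \<And>B. B \<in> \<B> \<Longrightarrow> x \<in> B \<longleftrightarrow> y \<in> B\<rbrakk> \<Longrightarrow> x = y"
    using M0 standard_borel_separating unfolding nontrivial_standard_prob_space_def by metis
  have coord: "{x \<in> space ?P. x i \<in> B} \<in> sets ?P" if "i \<in> I" "B \<in> sets M0" for i B
    using that by measurable
  \<comment> \<open>Measurability of the fixed point set: the separating family turns equality of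
    two coordinates into countably many conditions on single coordinates.\<close>
  have "{x \<in> space ?P. \<forall>i\<in>I. \<forall>B\<in>\<B>. x (f i) \<in> B \<longleftrightarrow> x i \<in> B} \<in> sets ?P"
    using coord \<B>(2) f(1) unfolding iff_conv_conj_imp
    by (intro sets.sets_Collect_countable_All' assms(2) \<B>(1) sets.sets_Collect_conj
        sets.sets_Collect_imp) blast+
  moreover have "?F = {x \<in> space ?P. \<forall>i\<in>I. \<forall>B\<in>\<B>. x (f i) \<in> B \<longleftrightarrow> x i \<in> B}"
  proof (intro Collect_cong conj_cong ball_cong refl iffI)
    fix x i assume x: "x \<in> space ?P" "i \<in> I" and eq: "\<forall>B\<in>\<B>. x (f i) \<in> B \<longleftrightarrow> x i \<in> B"
    have "x (f i) \<in> space M0" "x i \<in> space M0"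
      using x f(1) by (auto simp: space_PiM)
    then show "x (f i) = x i" using \<B>(3) eq by blast
  qed (simp_all add: bernoulli_space_def)
  ultimately have F: "?F \<in> sets ?P" by simp
  obtain A where A: "A \<in> sets M0" "0 < M0.prob A" "M0.prob A < 1"
    using nontrivial_standard_prob_space_event[OF M0] .
  define r where "r = M0.prob A * (1 - M0.prob A)"
  have "0 < r" using A by (simp add: r_def)
  have "r \<le> 1" using A unfolding r_def by (intro mult_le_one) auto
  have "P.prob ?F \<le> (1 - r) ^ n" for n
  proof -
    have "\<exists>J\<subseteq>{i \<in> I. f i \<noteq> i}. finite J \<and> card J = n \<and> J \<inter> f ` J = {}"
      using inf f(2) by (intro finite_disjoint_subset) (auto intro: inj_on_subset)
    then obtain J where J: "J \<subseteq> I" "finite J" "card J = n" "J \<inter> f ` J = {}" by blast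
    let ?Q = "{x \<in> space ?P. (\<forall>i\<in>J. \<not> (x i \<in> A \<and> x (f i) \<notin> A)) \<and>
      (\<forall>i\<in>{}. x i \<in> A \<and> x (f i) \<notin> A)}"
    have "P.prob ?Q = (1 - r) ^ card J * r ^ card ({} :: 'i set)"
      by (rule M0.measure_PiM_disjoint_pairs[OF A(1)])
        (use J f r_def in \<open>auto intro: inj_on_subset\<close>)
    then have eq: "P.prob ?Q = (1 - r) ^ n" using J(3) by simp
    moreover have "?Q \<in> sets ?P"
      using J A f by (intro sets_PiM_pairs) auto
    moreover have "?F \<subseteq> ?Q" using J by (auto simp: bernoulli_space_def)
    ultimately have "P.prob ?F \<le> P.prob ?Q" by (intro P.finite_measure_mono)
    then show ?thesis using eq by simp
  qed
  moreover have "(\<lambda>n. (1 - r) ^ n) \<longlonglongrightarrow> 0"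
    using \<open>0 < r\<close> \<open>r \<le> 1\<close> by (intro LIMSEQ_realpow_zero) auto
  ultimately have "P.prob ?F \<le> 0"
    by (intro LIMSEQ_le_const) auto
  then have "P.prob ?F = 0" using measure_nonneg[of ?P ?F] by linarith
  with F show ?thesis
    by (simp add: bernoulli_space_def null_sets_def P.emeasure_eq_measure)
qed

text \<open>The action of \<open>g\<close> on configurations permutes coordinates by
  \<open>inv g\<close>, so infinite support and the null set lemma are both used for
  \<open>inv g\<close>.\<close>

lemma (in group_action) MIF_bernoulli_essentially_free:
  assumes "MIF G" "nontrivial_standard_prob_space M0" "countable E"
    and faithful: "ae_faithful G (bernoulli_space E M0) (bernoulli_action G E \<phi> M0)"
  shows "essentially_free G (bernoulli_space E M0) (bernoulli_action G E \<phi> M0)"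
  unfolding essentially_free_def
proof
  interpret G: group G using group_hom by (simp add: group_hom_def)
  let ?P = "bernoulli_space E M0"
  have act: "bernoulli_action G E \<phi> M0 g x = x \<longleftrightarrow> (\<forall>i\<in>E. x (\<phi> (inv g) i) = x i)"
    if "x \<in> space ?P" for g x
    using that by (auto simp: bernoulli_action_def bernoulli_space_def space_PiM fun_eq_iff
        restrict_def PiE_def extensional_def)
  \<comment> \<open>An element fixing every index fixes every configuration, so faithfulness almost
    everywhere on the product gives faithfulness on the index set.\<close>
  have faithful': "u = \<one>" if u: "u \<in> carrier G" "\<And>i. i \<in> E \<Longrightarrow> \<phi> u i = i" for u
  proof (rule ccontr)
    assume "u \<noteq> \<one>"
    have "\<phi> (inv u) i = i" if "i \<in> E" for i using orbit_sym_aux u that by blast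
    then have "AE x in ?P. bernoulli_action G E \<phi> M0 u x = x"
      by (intro AE_I2) (simp add: act)
    then show False using faithful u(1) \<open>u \<noteq> \<one>\<close> by (auto simp: ae_faithful_def)
  qed
  fix g assume "g \<in> carrier G - {\<one>}"
  then have g: "inv g \<in> carrier G" "inv g \<noteq> \<one>" by auto
  have "{x \<in> space ?P. \<forall>i\<in>E. x (\<phi> (inv g) i) = x i} \<in> null_sets ?P"
  proof (rule bernoulli_fixed_points_null[OF assms(2,3)])
    show "\<phi> (inv g) ` E \<subseteq> E" using surj_prop[OF g(1)] by simp
    show "inj_on (\<phi> (inv g)) E" by (rule inj_prop[OF g(1)])
    show "infinite {i \<in> E. \<phi> (inv g) i \<noteq> i}"
      by (rule MIF_infinite_support[OF assms(1) g faithful'])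
  qed
  then show "{x \<in> space ?P. bernoulli_action G E \<phi> M0 g x = x} \<in> null_sets ?P"
    using act[of _ g] by (simp cong: conj_cong)
qed

section \<open>Affine actions\<close>

text \<open>The equalizer of two continuous maps into a Hausdorff space is closed. Since
  \<open>borel_of\<close> is generated by open sets, it is reached as the complement of an open
  set.\<close>

lemma affine_fixed_points_measurable:
  assumes K: "compact_abelian_group K T" and b: "b \<in> carrier K" and \<alpha>: "continuous_map T T \<alpha>"
    and M: "sets M = sets (borel_of T)"
  shows "{k \<in> carrier K. b \<otimes>\<^bsub>K\<^esub> \<alpha> k = k} \<in> sets M"
proof -
  have T: "topspace T = carrier K" "Hausdorff_space T"
    "continuous_map (prod_topology T T) T (\<lambda>(x, y). x \<otimes>\<^bsub>K\<^esub> y)"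
    using K by (auto simp: compact_abelian_group_def)
  have "continuous_map T (prod_topology T T) (\<lambda>k. (b, \<alpha> k))"
    using b \<alpha> T(1) by (intro continuous_map_pairedI) auto
  from continuous_map_compose[OF this T(3)] have "continuous_map T T (\<lambda>k. b \<otimes>\<^bsub>K\<^esub> \<alpha> k)"
    by (simp add: comp_def)
  then have "closedin T {k \<in> topspace T. b \<otimes>\<^bsub>K\<^esub> \<alpha> k = id k}"
    by (rule closedin_continuous_maps_eq[OF T(2)]) (rule continuous_map_id)
  then have "openin T (topspace T - {k \<in> topspace T. b \<otimes>\<^bsub>K\<^esub> \<alpha> k = id k})"
    by (rule openin_diff[OF openin_topspace])
  then have "topspace T - {k \<in> topspace T. b \<otimes>\<^bsub>K\<^esub> \<alpha> k = id k} \<in> sets (borel_of T)"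
    unfolding borel_of_def using openin_subset by (subst sets_measure_of) auto
  moreover have "space (borel_of T) = topspace T"
    unfolding borel_of_def using openin_subset by (intro space_measure_of) auto
  ultimately have "topspace T - (topspace T - {k \<in> topspace T. b \<otimes>\<^bsub>K\<^esub> \<alpha> k = id k}) \<in> sets (borel_of T)"
    using sets.compl_sets[of _ "borel_of T"] by metis
  also have "topspace T - (topspace T - {k \<in> topspace T. b \<otimes>\<^bsub>K\<^esub> \<alpha> k = id k})
      = {k \<in> carrier K. b \<otimes>\<^bsub>K\<^esub> \<alpha> k = k}" using T(1) by auto
  finally show ?thesis by (simp add: M)
qed

text \<open>
  The fixed point set is a fibre of \<open>k \<mapsto> \<alpha>(k) k\<inverse>\<close>, so all fibres over the image are translates
  of it with the same positive measure.
\<close>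

lemma finite_displacements:
  fixes K (structure)
  assumes "comm_group K" "prob_space M"
    and invariant: "\<And>a A. \<lbrakk>a \<in> carrier K; A \<in> sets M\<rbrakk> \<Longrightarrow> emeasure M (a <# A) = emeasure M A"
    and \<alpha>: "\<alpha> \<in> hom K K" and b: "b \<in> carrier K"
    and F: "{k \<in> carrier K. b \<otimes> \<alpha> k = k} \<in> sets M"
      "emeasure M {k \<in> carrier K. b \<otimes> \<alpha> k = k} \<noteq> 0"
  shows "finite ((\<lambda>k. \<alpha> k \<otimes> inv k) ` carrier K)"
proof (rule ccontr)
  interpret K: comm_group K by fact
  interpret M: prob_space M by fact
  let ?\<delta> = "\<lambda>k. \<alpha> k \<otimes> inv k"
  let ?F = "{k \<in> carrier K. b \<otimes> \<alpha> k = k}"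
  assume inf: "infinite (?\<delta> ` carrier K)"
  have \<alpha>_closed: "\<alpha> k \<in> carrier K" if "k \<in> carrier K" for k
    using hom_in_carrier[OF \<alpha> that] .
  \<comment> \<open>Commutativity of \<open>K\<close> makes the displacement map a
    homomorphism.\<close>
  have \<delta>_mult: "?\<delta> (y \<otimes> z) = ?\<delta> y \<otimes> ?\<delta> z" if "y \<in> carrier K" "z \<in> carrier K" for y z
    using that \<alpha>_closed by (simp add: hom_mult[OF \<alpha>] K.inv_mult K.m_ac)
  have \<delta>_F: "?\<delta> k = inv b" if "k \<in> ?F" for k
  proof -
    have k: "k \<in> carrier K" "b \<otimes> \<alpha> k = k" using that by auto
    have "\<alpha> k = inv b \<otimes> k"
      using K.inv_solve_left[of "\<alpha> k" b k] k \<alpha>_closed b by metis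
    then show ?thesis using k(1) b by (simp add: K.m_assoc)
  qed
  have pos: "0 < M.prob ?F" using F(2) by (simp add: M.emeasure_eq_measure zero_less_measure_iff)
  \<comment> \<open>Chosen so that \<open>n\<close> disjoint translates of \<open>?F\<close> would
    have total measure above 1.\<close>
  obtain n :: nat where n: "1 < n * M.prob ?F" using reals_Archimedean3[OF pos] by blast
  obtain L where L: "finite L" "card L = n" "L \<subseteq> ?\<delta> ` carrier K"
    using infinite_arbitrarily_large[OF inf] by blast
  then have "\<forall>l\<in>L. \<exists>y. y \<in> carrier K \<and> ?\<delta> y = l" by auto
  then obtain y where y: "\<And>l. l \<in> L \<Longrightarrow> y l \<in> carrier K" "\<And>l. l \<in> L \<Longrightarrow> ?\<delta> (y l) = l"
    by metis
  have prob: "M.prob (y l <# ?F) = M.prob ?F" if "l \<in> L" for l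
    using invariant[OF y(1)[OF that] F(1)] by (simp add: measure_def)
  \<comment> \<open>\<open>emeasure\<close> vanishes outside \<open>sets M\<close>, so a translate
    with the nonzero measure of \<open>?F\<close> is measurable.\<close>
  have sets: "y l <# ?F \<in> sets M" if "l \<in> L" for l
    using invariant[OF y(1)[OF that] F(1)] F(2) emeasure_notin_sets by metis
  have fibre: "?\<delta> x = l \<otimes> inv b" if "l \<in> L" "x \<in> y l <# ?F" for l x
  proof -
    obtain k where "k \<in> ?F" "x = y l \<otimes> k" using \<open>x \<in> _\<close> by (auto simp: l_coset_def)
    then show ?thesis using \<delta>_mult[OF y(1)[OF \<open>l \<in> L\<close>], of k] y(2)[OF \<open>l \<in> L\<close>] \<delta>_F[of k] by simp
  qed
  have "disjoint_family_on (\<lambda>l. y l <# ?F) L"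
    unfolding disjoint_family_on_def
  proof (intro ballI impI)
    fix l m assume lm: "l \<in> L" "m \<in> L" "l \<noteq> m"
    have carr: "l \<in> carrier K" "m \<in> carrier K" using lm L(3) \<alpha>_closed by auto
    have ne: "l \<otimes> inv b \<noteq> m \<otimes> inv b" using lm(3) carr b by simp
    show "(y l <# ?F) \<inter> (y m <# ?F) = {}"
    proof (rule equals0I)
      fix x assume x: "x \<in> (y l <# ?F) \<inter> (y m <# ?F)"
      from x have "?\<delta> x = l \<otimes> inv b" by (intro fibre[OF lm(1)]) (rule IntD1)
      moreover from x have "?\<delta> x = m \<otimes> inv b" by (intro fibre[OF lm(2)]) (rule IntD2)
      ultimately show False using ne by argo
    qed
  qed
  then have "M.prob (\<Union>l\<in>L. y l <# ?F) = (\<Sum>l\<in>L. M.prob (y l <# ?F))"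
    using L(1) sets by (intro M.finite_measure_finite_Union) auto
  also have "\<dots> = n * M.prob ?F" using prob L(2) by simp
  finally show False using n M.prob_le_1[of "\<Union>l\<in>L. y l <# ?F"] by simp
qed

section \<open>Bounded orbits of affine actions\<close>

text \<open>Finiteness of \<open>L\<close> controls both motions: \<open>g\<close> multiplies each
  point by an element of \<open>L\<close>, and \<open>h g h\<inverse>\<close> by an element of
  \<open>\<beta>(L)\<close>. The resulting bound \<open>card L * card L\<close> does not depend on
  \<open>h\<close>.\<close>

lemma MIF_affine_essentially_free:
  fixes G :: "('g, 'r) monoid_scheme" and K :: "('k, 's) monoid_scheme"
  assumes "MIF G" and K: "compact_abelian_group K T" and haar: "normalized_haar K T M"
    and affine: "affine_action G K T act" and faithful: "ae_faithful G M act"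
  shows "essentially_free G M act"
proof (rule ccontr)
  interpret A: group_action G "carrier K" act using affine by (simp add: affine_action_def)
  interpret G: group G using A.group_hom by (simp add: group_hom_def)
  interpret K: comm_group K using K by (simp add: compact_abelian_group_def)
  interpret M: prob_space M using haar by (simp add: normalized_haar_def)
  have M: "space M = carrier K" "sets M = sets (borel_of T)"
    "\<And>a A. \<lbrakk>a \<in> carrier K; A \<in> sets M\<rbrakk> \<Longrightarrow> emeasure M (a <#\<^bsub>K\<^esub> A) = emeasure M A"
    using haar K by (auto simp: normalized_haar_def compact_abelian_group_def)
  have aff: "\<exists>b \<alpha>. b \<in> carrier K \<and> \<alpha> \<in> hom K K \<and> continuous_map T T \<alpha> \<and>
      (\<forall>k\<in>carrier K. act g k = b \<otimes>\<^bsub>K\<^esub> \<alpha> k)" if "g \<in> carrier G" for g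
    using affine that unfolding affine_action_def iso_def by blast
  assume "\<not> ?thesis"
  then obtain g where g: "g \<in> carrier G" "g \<noteq> \<one>\<^bsub>G\<^esub>" "{k \<in> carrier K. act g k = k} \<notin> null_sets M"
    by (auto simp: essentially_free_def M(1))
  obtain b \<alpha> where b: "b \<in> carrier K" and \<alpha>: "\<alpha> \<in> hom K K" "continuous_map T T \<alpha>"
    and act_g: "\<And>k. k \<in> carrier K \<Longrightarrow> act g k = b \<otimes>\<^bsub>K\<^esub> \<alpha> k"
    using aff[OF g(1)] by blast
  let ?F = "{k \<in> carrier K. b \<otimes>\<^bsub>K\<^esub> \<alpha> k = k}"
  let ?\<delta> = "\<lambda>k. \<alpha> k \<otimes>\<^bsub>K\<^esub> inv\<^bsub>K\<^esub> k"
  define L where "L = ?\<delta> ` carrier K"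
  have "?F \<in> sets M" by (rule affine_fixed_points_measurable[OF K b \<alpha>(2) M(2)])
  moreover have "?F = {k \<in> carrier K. act g k = k}" using act_g by auto
  ultimately have F: "?F \<in> sets M" "emeasure M ?F \<noteq> 0" using g(3) by auto
  then have fin: "finite L"
    unfolding L_def
    by (intro finite_displacements[OF K.comm_group_axioms M.prob_space_axioms M(3) \<alpha>(1) b])
  have \<alpha>_closed: "\<alpha> k \<in> carrier K" if "k \<in> carrier K" for k
    using hom_in_carrier[OF \<alpha>(1) that] .
  have L_carrier: "l \<in> carrier K" if "l \<in> L" for l
    using that \<alpha>_closed by (auto simp: L_def)
  have L_mult: "l \<otimes>\<^bsub>K\<^esub> m \<in> L" if lm: "l \<in> L" "m \<in> L" for l m
  proof -
    obtain y z where yz: "y \<in> carrier K" "z \<in> carrier K" "l = ?\<delta> y" "m = ?\<delta> z"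
      using lm by (auto simp: L_def)
    then have "l \<otimes>\<^bsub>K\<^esub> m = ?\<delta> (y \<otimes>\<^bsub>K\<^esub> z)"
      using \<alpha>_closed by (simp add: hom_mult[OF \<alpha>(1)] K.inv_mult K.m_ac)
    then show ?thesis using yz by (auto simp: L_def)
  qed
  have L_one: "\<one>\<^bsub>K\<^esub> \<in> L"
    unfolding L_def
    by (rule image_eqI[of _ _ "\<one>\<^bsub>K\<^esub>"]) (simp_all add: hom_one[OF \<alpha>(1) K.is_group K.is_group])
  \<comment> \<open>A set of nonzero measure is nonempty; the fixed point \<open>k0\<close> serves
    as the origin of the affine map.\<close>
  obtain k0 where k0: "k0 \<in> carrier K" "b \<otimes>\<^bsub>K\<^esub> \<alpha> k0 = k0"
    using F(2) by (metis (mono_tags, lifting) Collect_empty_eq emeasure_empty)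
  have b_eq: "b = k0 \<otimes>\<^bsub>K\<^esub> inv\<^bsub>K\<^esub> (\<alpha> k0)"
    using K.inv_solve_right[of b k0 "\<alpha> k0"] k0 b \<alpha>_closed by metis
  \<comment> \<open>With origin \<open>k0\<close>, \<open>g\<close> becomes
    \<open>k0 d \<mapsto> k0 \<alpha>(d)\<close>, so the factor moving \<open>k\<close> is the
    displacement of \<open>d = k0\<inverse> k\<close>.\<close>
  have move: "\<exists>l\<in>L. act g k = l \<otimes>\<^bsub>K\<^esub> k" if k: "k \<in> carrier K" for k
  proof (intro bexI)
    let ?d = "inv\<^bsub>K\<^esub> k0 \<otimes>\<^bsub>K\<^esub> k"
    show "?\<delta> ?d \<in> L" unfolding L_def using k k0 by (intro imageI) simp
    have "\<alpha> ?d = inv\<^bsub>K\<^esub> (\<alpha> k0) \<otimes>\<^bsub>K\<^esub> \<alpha> k"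
    proof -
      interpret \<alpha>: group_hom K K \<alpha> by unfold_locales (rule \<alpha>(1))
      show ?thesis using k k0 by simp
    qed
    moreover have "inv\<^bsub>K\<^esub> ?d = k0 \<otimes>\<^bsub>K\<^esub> inv\<^bsub>K\<^esub> k"
      using k k0(1) by (simp add: K.inv_mult)
    \<comment> \<open>This is used at \<open>v = k\<inverse>\<close>, which cancels against
      \<open>k\<close> only in the last step.\<close>
    moreover have "inv\<^bsub>K\<^esub> (\<alpha> k0) \<otimes>\<^bsub>K\<^esub> \<alpha> k \<otimes>\<^bsub>K\<^esub> (k0 \<otimes>\<^bsub>K\<^esub> v) \<otimes>\<^bsub>K\<^esub> k
        = b \<otimes>\<^bsub>K\<^esub> \<alpha> k \<otimes>\<^bsub>K\<^esub> (v \<otimes>\<^bsub>K\<^esub> k)" if "v \<in> carrier K" for v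
      using that k k0(1) \<alpha>_closed by (simp add: b_eq K.m_ac)
    ultimately have "?\<delta> ?d \<otimes>\<^bsub>K\<^esub> k = b \<otimes>\<^bsub>K\<^esub> \<alpha> k \<otimes>\<^bsub>K\<^esub> (inv\<^bsub>K\<^esub> k \<otimes>\<^bsub>K\<^esub> k)"
      using k by (simp only: K.inv_closed)
    then show "act g k = ?\<delta> ?d \<otimes>\<^bsub>K\<^esub> k"
      using k b \<alpha>_closed by (simp add: act_g)
  qed
  have faithful': "u = \<one>\<^bsub>G\<^esub>" if "u \<in> carrier G" "\<And>k. k \<in> carrier K \<Longrightarrow> act u k = k" for u
  proof (rule ccontr)
    assume "u \<noteq> \<one>\<^bsub>G\<^esub>"
    moreover have "AE k in M. act u k = k" by (intro AE_I2) (simp add: M(1) that(2))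
    ultimately show False using faithful that(1) by (auto simp: ae_faithful_def)
  qed
  have "g = \<one>\<^bsub>G\<^esub>"
  proof (rule A.MIF_bounded_orbits[OF assms(1) g(1) faithful', where n = "card L * card L"])
    fix h k assume h: "h \<in> carrier G" and k: "k \<in> carrier K"
    obtain c \<beta> where c: "c \<in> carrier K" and \<beta>: "\<beta> \<in> hom K K"
      and act_h: "\<And>k. k \<in> carrier K \<Longrightarrow> act h k = c \<otimes>\<^bsub>K\<^esub> \<beta> k"
      using aff[OF h] by blast
    have \<beta>_closed: "\<beta> k \<in> carrier K" if "k \<in> carrier K" for k
      using hom_in_carrier[OF \<beta> that] .
    let ?g' = "h \<otimes>\<^bsub>G\<^esub> g \<otimes>\<^bsub>G\<^esub> inv\<^bsub>G\<^esub> h"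
    have move': "\<exists>l\<in>L. act ?g' m = \<beta> l \<otimes>\<^bsub>K\<^esub> m" if m: "m \<in> carrier K" for m
    proof -
      let ?m = "act (inv\<^bsub>G\<^esub> h) m"
      have m': "?m \<in> carrier K" using A.element_image h m by blast
      obtain l where l: "l \<in> L" "act g ?m = l \<otimes>\<^bsub>K\<^esub> ?m" using move[OF m'] by blast
      have "act ?g' m = act h (act g ?m)"
        using A.composition_rule[OF m, of "h \<otimes>\<^bsub>G\<^esub> g" "inv\<^bsub>G\<^esub> h"]
          A.composition_rule[OF m', of h g] g h by simp
      \<comment> \<open>The affine map of \<open>h\<close> turns multiplication by \<open>l\<close>
        into multiplication by \<open>\<beta> l\<close>; the translation part \<open>c\<close> is
        absorbed into \<open>act h ?m\<close>.\<close>
      also have "\<dots> = \<beta> l \<otimes>\<^bsub>K\<^esub> act h ?m"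
        using l m' c L_carrier[OF l(1)] \<beta>_closed by (simp add: act_h hom_mult[OF \<beta>] K.m_ac)
      also have "act h ?m = m"
        using A.orbit_sym_aux[of "inv\<^bsub>G\<^esub> h" m ?m] h m by simp
      finally show ?thesis using l(1) by blast
    qed
    \<comment> \<open>The translate of \<open>L \<beta>(L)\<close> by \<open>k\<close>. Moving by
      \<open>g\<close> changes only the first factor, moving by the conjugate only the second, and
      both stay in \<open>L\<close> by closure under products.\<close>
    let ?s = "\<lambda>(l, l'). l \<otimes>\<^bsub>K\<^esub> (\<beta> l' \<otimes>\<^bsub>K\<^esub> k)"
    let ?S = "?s ` (L \<times> L)"
    have S: "?S \<subseteq> carrier K" using L_carrier \<beta>_closed k by auto
    have "k = ?s (\<one>\<^bsub>K\<^esub>, \<one>\<^bsub>K\<^esub>)" using k by (simp add: hom_one[OF \<beta> K.is_group K.is_group])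
    then have "k \<in> ?S" using L_one by blast
    moreover have "card ?S \<le> card L * card L"
      using card_image_le[of "L \<times> L" ?s] fin by (simp add: card_cartesian_product)
    moreover have "act g m \<in> ?S" if m: "m \<in> ?S" for m
    proof -
      obtain l l' where l: "l \<in> L" "l' \<in> L" "m = ?s (l, l')" using m by auto
      obtain d where d: "d \<in> L" "act g m = d \<otimes>\<^bsub>K\<^esub> m" using move m S by blast
      have "act g m = ?s (d \<otimes>\<^bsub>K\<^esub> l, l')"
        using d l L_carrier \<beta>_closed k by (simp add: K.m_assoc)
      then show ?thesis using L_mult[OF d(1) l(1)] l(2) by blast
    qed
    moreover have "act ?g' m \<in> ?S" if m: "m \<in> ?S" for m
    proof -
      obtain l l' where l: "l \<in> L" "l' \<in> L" "m = ?s (l, l')" using m by auto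
      obtain d where d: "d \<in> L" "act ?g' m = \<beta> d \<otimes>\<^bsub>K\<^esub> m" using move' m S by blast
      have "act ?g' m = ?s (l, d \<otimes>\<^bsub>K\<^esub> l')"
        using d l L_carrier \<beta>_closed k by (simp add: hom_mult[OF \<beta>] K.m_ac)
      then show ?thesis using L_mult[OF d(1) l(2)] l(1) by blast
    qed
    ultimately show "\<exists>S. finite S \<and> card S \<le> card L * card L \<and> k \<in> S \<and> S \<subseteq> carrier K \<and>
        act g ` S \<subseteq> S \<and> act ?g' ` S \<subseteq> S"
      using fin S by (intro exI[of _ ?S]) blast
  qed
  with g(2) show False by contradiction
qed

theorem theorem1:
  fixes G :: "('g, 'r) monoid_scheme"
    and I :: "'i set" and \<phi> :: "'g \<Rightarrow> 'i \<Rightarrow> 'i" and M0 :: "'a measure"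
    and K :: "('k, 's) monoid_scheme" and T :: "'k topology" and \<mu> :: "'k measure"
    and act :: "'g \<Rightarrow> 'k \<Rightarrow> 'k"
  assumes "group G" and "countable (carrier G)" and "MIF G"
  shows "(nontrivial_standard_prob_space M0 \<and> countable I \<and> infinite I \<and> group_action G I \<phi> \<and>
           ae_faithful G (bernoulli_space I M0) (bernoulli_action G I \<phi> M0) \<and>
           ergodic_action G (bernoulli_space I M0) (bernoulli_action G I \<phi> M0)
           \<longrightarrow> essentially_free G (bernoulli_space I M0) (bernoulli_action G I \<phi> M0))
       \<and> (compact_abelian_group K T \<and> normalized_haar K T \<mu> \<and> affine_action G K T act \<and>
           ae_faithful G \<mu> act
           \<longrightarrow> essentially_free G \<mu> act)"
proof (intro conjI impI; elim conjE)
  assume "nontrivial_standard_prob_space M0" "countable I" "group_action G I \<phi>"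
    "ae_faithful G (bernoulli_space I M0) (bernoulli_action G I \<phi> M0)"
  then show "essentially_free G (bernoulli_space I M0) (bernoulli_action G I \<phi> M0)"
    using group_action.MIF_bernoulli_essentially_free assms(3) by blast
next
  assume "compact_abelian_group K T" "normalized_haar K T \<mu>" "affine_action G K T act"
    "ae_faithful G \<mu> act"
  then show "essentially_free G \<mu> act"
    by (rule MIF_affine_essentially_free[OF assms(3)])
qed

end
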